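(* Let $M$ be a monoid and $S$ an entire-like semiring. If $S[M]$ is a McCoy $S$-semialgebra, then $S[M]$ is entire-like.
   Context: A semiring is a set $S$ with operations $+,\cdot$ such that $(S,+,0)$ and $(S,\cdot,1)$ are commutative monoids with $1\neq 0$, multiplication distributes over addition, and $s\cdot 0=0$ for all $s$. $Z(S)$ is the set of zero-divisors of $S$, i.e. of $z\in S$ with $zs=0$ for some nonzero $s\in S$; $\mathrm{Nil}(S)$ is the set of nilpotent elements. $S$ is entire-like if $Z(S)\subseteq\mathrm{Nil}(S)$. All monoids are commutative and written additively. $S[M]$ is the monoid semiring, whose elements are finite formal sums $\sum_i s_iX^{m_i}$ with $s_i\in S$, $m_i\in M$, and $X^mX^{m'}=X^{m+m'}$. For $f\in S[M]$, the content $c(f)$ is the ideal of $S$ generated by the coefficients of $f$. $S[M]$ is a McCoy $S$-semialgebra if for all $f,g\in S[M]$, $fg=0$ and $g\neq 0$ imply that there is a nonzero $s\in S$ with $s\,c(f)=(0)$. *)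

theory Defs
  imports Complex_Main "HOL-Library.Poly_Mapping"
begin

text \<open>
  A semiring in the sense of the source (commutative, with \<open>1 \<noteq> 0\<close>) is a type of class
  \<^class>\<open>comm_semiring_1\<close>, and a monoid is a type of class \<^class>\<open>comm_monoid_add\<close>.
  The monoid semiring \<open>S[M]\<close> is the type \<open>'m \<Rightarrow>\<^sub>0 's\<close> with the convolution product.
\<close>

definition zero_divisors :: "'s::comm_semiring_1 set" where
  "zero_divisors = {z. \<exists>s. s \<noteq> 0 \<and> z * s = 0}"

definition nilpotents :: "'s::comm_semiring_1 set" where
  "nilpotents = {z. \<exists>n::nat. z ^ n = 0}"

definition entire_like :: "'s::comm_semiring_1 itself \<Rightarrow> bool" where
  "entire_like _ \<longleftrightarrow> (zero_divisors :: 's set) \<subseteq> nilpotents"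

definition semiring_ideal :: "'s::comm_semiring_1 set \<Rightarrow> bool" where
  "semiring_ideal I \<longleftrightarrow>
     0 \<in> I \<and> (\<forall>a\<in>I. \<forall>b\<in>I. a + b \<in> I) \<and> (\<forall>s. \<forall>a\<in>I. s * a \<in> I)"

definition content_ideal :: "('m \<Rightarrow>\<^sub>0 's::comm_semiring_1) \<Rightarrow> 's set" where
  "content_ideal f = semiring_ideal hull (Poly_Mapping.range f)"

definition mccoy_semialgebra ::
  "'m::comm_monoid_add itself \<Rightarrow> 's::comm_semiring_1 itself \<Rightarrow> bool" where
  "mccoy_semialgebra _ _ \<longleftrightarrow>
     (\<forall>f g :: 'm \<Rightarrow>\<^sub>0 's. f * g = 0 \<and> g \<noteq> 0 \<longrightarrow>
        (\<exists>s. s \<noteq> 0 \<and> (\<lambda>a. s * a) ` content_ideal f = {0}))"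

lemma semiring_ideal_content_ideal: "semiring_ideal (content_ideal f)"
  unfolding content_ideal_def
  by (rule hull_in) (auto simp: semiring_ideal_def)

lemma lookup_in_content_ideal: "Poly_Mapping.lookup f m \<in> content_ideal f"
proof (cases "Poly_Mapping.lookup f m = 0")
  case True
  then show ?thesis
    using semiring_ideal_content_ideal[of f] by (simp add: semiring_ideal_def)
next
  case False
  then show ?thesis
    unfolding content_ideal_def by (intro hull_inc) (simp add: range.rep_eq)
qed

end

theory Submission
  imports Defs
begin

text \<open>
  If \<open>f * g = 0\<close> with \<open>g \<noteq> 0\<close>, the McCoy property provides one nonzero \<open>s\<close> killing every coefficient
  of \<open>f\<close>. Hence all coefficients are zero-divisors of \<open>S\<close>, so they are nilpotent, and \<open>f\<close> is a finite
  sum of nilpotent monomials.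
\<close>

lemma zero_in_nilpotents: "(0::'a::comm_semiring_1) \<in> nilpotents"
proof -
  \<comment> \<open>The exponent must be positive, as \<open>0 ^ 0 = 1\<close>.\<close>
  have "(0::'a) ^ 1 = 0" by simp
  then show ?thesis unfolding nilpotents_def by blast
qed

text \<open>In each term of the binomial expansion of \<open>(a + b) ^ (n + k)\<close>, either
  \<open>a\<close> has exponent at least \<open>n\<close> or \<open>b\<close> has exponent at least
  \<open>k\<close>.\<close>

lemma add_in_nilpotents:
  assumes "a \<in> nilpotents" and "b \<in> nilpotents"
  shows "a + b \<in> nilpotents"
proof -
  obtain n k where n: "a ^ n = 0" and k: "b ^ k = 0"
    using assms unfolding nilpotents_def by blast
  have zero: "a ^ i * b ^ (n + k - i) = 0" for i
  proof (cases "n \<le> i")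
    case True
    then have "a ^ i = a ^ n * a ^ (i - n)" by (simp flip: power_add)
    with n show ?thesis by simp
  next
    case False
    then have "b ^ (n + k - i) = b ^ k * b ^ (n - i)" by (simp add: add.commute flip: power_add)
    with k show ?thesis by simp
  qed
  have "(a + b) ^ (n + k) = 0"
    unfolding binomial_ring by (rule sum.neutral) (simp add: mult.assoc zero)
  then show ?thesis
    unfolding nilpotents_def by blast
qed

lemma sum_in_nilpotents:
  assumes "\<And>i. i \<in> A \<Longrightarrow> f i \<in> nilpotents"
  shows "sum f A \<in> nilpotents"
  using assms
  \<comment> \<open>For infinite \<open>A\<close> the sum is 0 by convention, so
    \<open>zero_in_nilpotents\<close> settles this case as well as the empty one.\<close>
  by (induction A rule: infinite_finite_induct)
    (auto intro: zero_in_nilpotents add_in_nilpotents)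

text \<open>Powers of a monomial are monomials whose coefficients are the powers of
  \<open>a\<close>. Only the coefficient decides vanishing, so the induction leaves the exponent
  \<open>m'\<close> existential.\<close>

lemma single_power_eq_zero:
  fixes m :: "'m::comm_monoid_add" and a :: "'s::comm_semiring_1"
  assumes "a ^ n = 0"
  shows "Poly_Mapping.single m a ^ n = 0"
proof -
  have "\<exists>m'. Poly_Mapping.single m a ^ k = Poly_Mapping.single m' (a ^ k)" for k
  proof (induction k)
    case 0
    have "Poly_Mapping.single m a ^ 0 = Poly_Mapping.single 0 (a ^ 0)" by simp
    then show ?case by blast
  next
    case (Suc k)
    then obtain m' where "Poly_Mapping.single m a ^ k = Poly_Mapping.single m' (a ^ k)" ..
    then have "Poly_Mapping.single m a ^ Suc k = Poly_Mapping.single (m + m') (a ^ Suc k)"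
      by (simp add: mult_single)
    then show ?case by blast
  qed
  then show ?thesis
    using assms by (metis single_zero)
qed

lemma poly_mapping_eq_sum_single:
  fixes f :: "'m \<Rightarrow>\<^sub>0 's::comm_monoid_add"
  shows "f = (\<Sum>m\<in>Poly_Mapping.keys f. Poly_Mapping.single m (Poly_Mapping.lookup f m))"
  by (rule poly_mapping_eqI)
    (auto simp: lookup_sum lookup_single when_def in_keys_iff)

lemma in_nilpotents_if_lookup_in_nilpotents:
  fixes f :: "'m::comm_monoid_add \<Rightarrow>\<^sub>0 's::comm_semiring_1"
  assumes "\<And>m. Poly_Mapping.lookup f m \<in> nilpotents"
  shows "f \<in> nilpotents"
proof -
  have "Poly_Mapping.single m (Poly_Mapping.lookup f m) \<in> nilpotents" for m
    using assms[of m] single_power_eq_zero unfolding nilpotents_def by blast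
  then show ?thesis
    by (subst poly_mapping_eq_sum_single[of f]) (rule sum_in_nilpotents)
qed

theorem proposition5p9:
  assumes "entire_like TYPE('s::comm_semiring_1)"
    and "mccoy_semialgebra TYPE('m::comm_monoid_add) TYPE('s)"
  shows "entire_like TYPE('m \<Rightarrow>\<^sub>0 's)"
  unfolding entire_like_def
proof
  fix f :: "'m \<Rightarrow>\<^sub>0 's"
  assume "f \<in> zero_divisors"
  then obtain g where "g \<noteq> 0" "f * g = 0"
    unfolding zero_divisors_def by blast
  then obtain s where s: "s \<noteq> 0" "(\<lambda>a. s * a) ` content_ideal f = {0}"
    using assms(2) unfolding mccoy_semialgebra_def by blast
  have "Poly_Mapping.lookup f m * s = 0" for m
    \<comment> \<open>Each coefficient lies in the content ideal, so its multiple by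
      \<open>s\<close> lies in the image, which is \<open>{0}\<close>.\<close>
    using imageI[OF lookup_in_content_ideal[of f m], of "\<lambda>a. s * a"] unfolding s(2)
    by (simp add: mult.commute)
  then have "Poly_Mapping.lookup f m \<in> zero_divisors" for m
    using s(1) unfolding zero_divisors_def by blast
  then have "Poly_Mapping.lookup f m \<in> nilpotents" for m
    using assms(1) unfolding entire_like_def by (rule subsetD[rotated])
  then show "f \<in> nilpotents"
    by (rule in_nilpotents_if_lookup_in_nilpotents)
qed

end
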